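(* Let $G$ be a finite connected graph with embedding scheme $\Pi=(\pi,\lambda)$, and let $\mathcal{C}=\mathcal{C}_1\cup\mathcal{C}_2$ be as defined in the context (for an arbitrary choice of breadth-first-search trees $T_x$, $x\in V(G)$). Then: (a) if $G$ contains a $\Pi$-twosided cycle, then $\mathcal{C}$ contains a $\Pi$-twosided cycle of minimum length among all $\Pi$-twosided cycles of $G$; (b) every even cycle of $G$ whose length is minimum among all even cycles of $G$ belongs to $\mathcal{C}$; (c) if a shortest cycle of $G$ (i.e. a cycle of length equal to the girth of $G$) has odd length, then every odd cycle of $G$ whose length is minimum among all odd cycles of $G$ belongs to $\mathcal{C}_1$.
   Context: Graphs are finite and connected; cycles are identified with their edge sets and the length $|C|$ of a cycle is its number of edges. An embedding scheme of $G$ is $\Pi=(\pi,\lambda)$ where $\pi=\{\pi_v: v\in V(G)\}$ is a rotation system ($\pi_v$ a cyclic ordering of the edges incident with $v$) and $\lambda:E(G)\to\{-1,+1\}$ is a signature. A cycle is $\Pi$-twosided if it contains an even number of edges $e$ with $\lambda(e)=-1$, and $\Pi$-onesided otherwise. For each vertex $x$, $T_x$ denotes a breadth-first-search spanning tree of $G$ rooted at $x$ (so the path in $T_x$ from $x$ to any vertex is a shortest path in $G$). A fundamental cycle of a spanning tree $T$ is the unique cycle in $T+e$ for an edge $e\notin E(T)$. $\mathcal{C}_1$ is the set of all fundamental cycles of the trees $T_x$, $x\in V(G)$; $\mathcal{C}_2$ is the set of all cycles $C$ of $G$ such that $C=C_a\oplus C_b$ for some $C_a,C_b\in\mathcal{C}_1$,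 where $A\oplus B=(A\setminus B)\cup(B\setminus A)$ for edge sets $A,B$; and $\mathcal{C}=\mathcal{C}_1\cup\mathcal{C}_2$. *)

theory Defs
  imports Main
begin

text \<open>Finite (multi)graphs: vertex set V, edge set E, and an incidence map
  ends assigning to each edge its set of one (loop) or two end vertices.\<close>

definition graph :: "'a set \<Rightarrow> 'e set \<Rightarrow> ('e \<Rightarrow> 'a set) \<Rightarrow> bool" where
  "graph V E ends \<longleftrightarrow> finite V \<and> finite E \<and>
     (\<forall>e\<in>E. ends e \<subseteq> V \<and> (card (ends e) = 1 \<or> card (ends e) = 2))"

inductive walk :: "'a set \<Rightarrow> 'e set \<Rightarrow> ('e \<Rightarrow> 'a set) \<Rightarrow> 'a \<Rightarrow> 'e list \<Rightarrow> 'a \<Rightarrow> bool"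
  for V E ends where
  Nil: "u \<in> V \<Longrightarrow> walk V E ends u [] u"
| Cons: "e \<in> E \<Longrightarrow> ends e = {u, w} \<Longrightarrow> u \<in> V \<Longrightarrow> walk V E ends w es v
          \<Longrightarrow> walk V E ends u (e # es) v"

definition connected_graph :: "'a set \<Rightarrow> 'e set \<Rightarrow> ('e \<Rightarrow> 'a set) \<Rightarrow> bool" where
  "connected_graph V E ends \<longleftrightarrow> (\<forall>u\<in>V. \<forall>v\<in>V. \<exists>es. walk V E ends u es v)"

definition gdist :: "'a set \<Rightarrow> 'e set \<Rightarrow> ('e \<Rightarrow> 'a set) \<Rightarrow> 'a \<Rightarrow> 'a \<Rightarrow> nat" where
  "gdist V E ends u v = (LEAST n. \<exists>es. walk V E ends u es v \<and> length es = n)"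

text \<open>Vertices covered by an edge set, and the degree of a vertex in an edge set
  (loops count twice).\<close>
definition verts :: "('e \<Rightarrow> 'a set) \<Rightarrow> 'e set \<Rightarrow> 'a set" where
  "verts ends C = \<Union> (ends ` C)"

definition deg :: "('e \<Rightarrow> 'a set) \<Rightarrow> 'e set \<Rightarrow> 'a \<Rightarrow> nat" where
  "deg ends C v = card {e\<in>C. v \<in> ends e} + card {e\<in>C. ends e = {v}}"

text \<open>A cycle (identified with its edge set): a nonempty set of edges forming a
  connected 2-regular subgraph.\<close>
definition is_cycle :: "'a set \<Rightarrow> 'e set \<Rightarrow> ('e \<Rightarrow> 'a set) \<Rightarrow> 'e set \<Rightarrow> bool" where
  "is_cycle V E ends C \<longleftrightarrow> C \<subseteq> E \<and> C \<noteq> {} \<and>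
     (\<forall>v\<in>verts ends C. deg ends C v = 2) \<and>
     connected_graph (verts ends C) C ends"

definition spanning_tree :: "'a set \<Rightarrow> 'e set \<Rightarrow> ('e \<Rightarrow> 'a set) \<Rightarrow> 'e set \<Rightarrow> bool" where
  "spanning_tree V E ends T \<longleftrightarrow> T \<subseteq> E \<and> connected_graph V T ends \<and>
     \<not> (\<exists>C. is_cycle V T ends C)"

definition bfs_tree :: "'a set \<Rightarrow> 'e set \<Rightarrow> ('e \<Rightarrow> 'a set) \<Rightarrow> 'a \<Rightarrow> 'e set \<Rightarrow> bool" where
  "bfs_tree V E ends x T \<longleftrightarrow> spanning_tree V E ends T \<and>
     (\<forall>v\<in>V. gdist V T ends x v = gdist V E ends x v)"

definition fundamental_cycles :: "'a set \<Rightarrow> 'e set \<Rightarrow> ('e \<Rightarrow> 'a set) \<Rightarrow> 'e set \<Rightarrow> 'e set set" where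
  "fundamental_cycles V E ends T =
     {C. \<exists>e\<in>E - T. is_cycle V E ends C \<and> C \<subseteq> insert e T}"

definition symdiff :: "'e set \<Rightarrow> 'e set \<Rightarrow> 'e set" where
  "symdiff A B = (A - B) \<union> (B - A)"

definition Cyc1 :: "'a set \<Rightarrow> 'e set \<Rightarrow> ('e \<Rightarrow> 'a set) \<Rightarrow> ('a \<Rightarrow> 'e set) \<Rightarrow> 'e set set" where
  "Cyc1 V E ends Tr = (\<Union>x\<in>V. fundamental_cycles V E ends (Tr x))"

definition Cyc2 :: "'a set \<Rightarrow> 'e set \<Rightarrow> ('e \<Rightarrow> 'a set) \<Rightarrow> ('a \<Rightarrow> 'e set) \<Rightarrow> 'e set set" where
  "Cyc2 V E ends Tr = {C. is_cycle V E ends C \<and>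
     (\<exists>Ca\<in>Cyc1 V E ends Tr. \<exists>Cb\<in>Cyc1 V E ends Tr. C = symdiff Ca Cb)}"

definition twosided :: "('e \<Rightarrow> int) \<Rightarrow> 'e set \<Rightarrow> bool" where
  "twosided lam C \<longleftrightarrow> even (card {e\<in>C. lam e = -1})"

end

theory Submission
  imports Defs
begin

text \<open>
  Root a breadth-first-search tree \<open>T\<close> at a vertex \<open>x\<close> of a minimum cycle \<open>C\<close>, and let \<open>d\<close> be the
  distance from \<open>x\<close>. Every edge \<open>e\<close> outside \<open>T\<close> determines a unique edge set \<open>fc e\<close> with all degrees
  even and \<open>fc e - T = {e}\<close>; it is the fundamental cycle of \<open>e\<close>, and \<open>symdiff (fc e) (fc f)\<close> is a
  cycle as soon as \<open>fc e\<close> and \<open>fc f\<close> share an edge. Closing up a piece of \<open>C\<close> with the tree paths from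
  \<open>x\<close> to its ends never exceeds the length of \<open>C\<close>, since \<open>d\<close> is at most the distance along \<open>C\<close>. Hence
  \<open>card (fc e) \<le> card C\<close> for \<open>e\<close> in \<open>C - T\<close>, and \<open>symdiff (fc e) (fc f)\<close> has at most \<open>card C\<close> edges
  when \<open>e\<close>, \<open>f\<close> are consecutive elements of \<open>C - T\<close> along \<open>C\<close>. If no \<open>fc e\<close> is twosided, then any two
  of them that share an edge give a twosided cycle, and a longest \<open>fc e\<close> must share an edge with a
  consecutive one: otherwise the neighbour, which has to meet some \<open>fc g\<close>, would give a twosided
  cycle shorter than \<open>C\<close>. Part (b) is the signature \<open>-1\<close>, where parity of distances
  shows in addition that \<open>C - T\<close> has at most two elements; in part (c) only the edge of \<open>C\<close> opposite
  to \<open>x\<close> can be outside \<open>T\<close>.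
\<close>

section \<open>Even edge sets\<close>

lemma card_symdiff:
  assumes "finite A" "finite B"
  shows "card (symdiff A B) + 2 * card (A \<inter> B) = card A + card B"
proof -
  have "card (symdiff A B) = card (A - B) + card (B - A)"
    unfolding symdiff_def using assms by (intro card_Un_disjoint) auto
  moreover have "card A = card (A - B) + card (A \<inter> B)"
    using assms by (metis Int_commute add.commute card_Int_Diff)
  moreover have "card B = card (B - A) + card (A \<inter> B)"
    using assms by (metis Int_commute add.commute card_Int_Diff)
  ultimately show ?thesis by simp
qed

lemma symdiff_Diff: "symdiff A B - T = symdiff (A - T) (B - T)"
  unfolding symdiff_def by blast

lemma even_card_symdiff:
  assumes "finite A" "finite B"
  shows "even (card (symdiff A B)) \<longleftrightarrow> (even (card A) \<longleftrightarrow> even (card B))"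
  using card_symdiff[OF assms] by presburger

lemma even_card_Collect_symdiff:
  assumes "finite A" "finite B"
  shows "even (card {h \<in> symdiff A B. P h}) \<longleftrightarrow>
    (even (card {h \<in> A. P h}) \<longleftrightarrow> even (card {h \<in> B. P h}))"
proof -
  have "{h \<in> symdiff A B. P h} = symdiff {h \<in> A. P h} {h \<in> B. P h}"
    unfolding symdiff_def by auto
  then show ?thesis using assms by (simp add: even_card_symdiff)
qed

lemma even_deg_symdiff:
  assumes "finite A" "finite B"
  shows "even (deg ends (symdiff A B) v) \<longleftrightarrow> (even (deg ends A v) \<longleftrightarrow> even (deg ends B v))"
  unfolding deg_def using even_card_Collect_symdiff[OF assms] by auto

lemma deg_insert:
  assumes "finite A" "e \<notin> A"
  shows "deg ends (insert e A) v = deg ends A v + of_bool (v \<in> ends e) + of_bool (ends e = {v})"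
proof -
  have *: "card {h \<in> insert e A. P h} = card {h \<in> A. P h} + of_bool (P e)" for P
  proof -
    have "{h \<in> insert e A. P h} = (if P e then insert e {h \<in> A. P h} else {h \<in> A. P h})"
      by auto
    then show ?thesis using assms by auto
  qed
  show ?thesis unfolding deg_def * by simp
qed

lemma deg_empty [simp]: "deg ends {} v = 0"
  by (simp add: deg_def)

lemma incidence_eq:
  "ends e = {u, w} \<Longrightarrow>
    of_bool (v \<in> ends e) + of_bool (ends e = {v}) = (of_bool (u = v) + of_bool (w = v) :: nat)"
  by auto

lemma deg_mono: "finite B \<Longrightarrow> A \<subseteq> B \<Longrightarrow> deg ends A v \<le> deg ends B v"
  unfolding deg_def by (intro add_mono card_mono) auto

lemma deg_pos_iff:
  assumes "finite A" shows "0 < deg ends A v \<longleftrightarrow> v \<in> verts ends A"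
  unfolding deg_def verts_def using assms by (auto simp: card_gt_0_iff)

text \<open>The sum of the list modulo 2: the edges occurring an odd number of times. Walks closed
  up by tree paths may repeat edges, and cancelling the repetitions avoids any search for simple
  paths.\<close>

fun odd_edges :: "'e list \<Rightarrow> 'e set" where
  "odd_edges [] = {}"
| "odd_edges (e # es) = symdiff {e} (odd_edges es)"

lemma odd_edges_subset: "odd_edges es \<subseteq> set es"
  by (induction es) (auto simp: symdiff_def)

lemma finite_odd_edges [simp]: "finite (odd_edges es)"
  by (rule finite_subset[OF odd_edges_subset finite_set])

lemma odd_edges_append: "odd_edges (xs @ ys) = symdiff (odd_edges xs) (odd_edges ys)"
  by (induction xs) (auto simp: symdiff_def)

lemma odd_edges_distinct: "distinct es \<Longrightarrow> odd_edges es = set es"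
  by (induction es) (auto simp: symdiff_def)

lemma card_odd_edges_le: "card (odd_edges es) \<le> length es"
  using card_mono[OF finite_set odd_edges_subset] card_length[of es] by (rule le_trans)

lemma even_card_odd_edges: "even (card (odd_edges es)) \<longleftrightarrow> even (length es)"
  by (induction es) (simp_all add: even_card_symdiff)

section \<open>Walks as edge lists and their vertex positions\<close>

lemma walk_append:
  "walk V E ends u xs w \<Longrightarrow> walk V E ends w ys v \<Longrightarrow> walk V E ends u (xs @ ys) v"
  by (induction rule: walk.induct) (auto intro: walk.Cons)

lemma walk_start: "walk V E ends u es v \<Longrightarrow> u \<in> V"
  by (erule walk.cases) auto

lemma walk_end: "walk V E ends u es v \<Longrightarrow> v \<in> V"
  by (induction rule: walk.induct) auto

lemma walk_edges: "walk V E ends u es v \<Longrightarrow> set es \<subseteq> E"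
  by (induction rule: walk.induct) auto

lemma walk_single:
  "e \<in> E \<Longrightarrow> ends e = {u, w} \<Longrightarrow> u \<in> V \<Longrightarrow> w \<in> V \<Longrightarrow> walk V E ends u [e] w"
  by (rule walk.Cons) (auto intro: walk.Nil)

lemma walk_rev: "walk V E ends u es v \<Longrightarrow> walk V E ends v (rev es) u"
proof (induction rule: walk.induct)
  case (Cons e u w es v)
  have "walk V E ends w [e] u"
    using Cons by (intro walk_single) (auto simp: insert_commute dest: walk_start)
  then show ?case using walk_append Cons by fastforce
qed (auto intro: walk.Nil)

lemma walk_transfer:
  assumes "walk V E ends u es v" "set es \<subseteq> F" "verts ends F \<subseteq> W" "u \<in> W"
  shows "walk W F ends u es v"
  using assms
proof (induction rule: walk.induct)
  case (Cons e u w es v)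
  then have "w \<in> W" by (auto simp: verts_def)
  then show ?case using Cons by (auto intro: walk.Cons)
qed (auto intro: walk.Nil)

text \<open>Each passage through a vertex adds two to its degree, so only the two ends of the walk
  can be odd; cancelling repeated edges in pairs preserves this parity.\<close>

lemma odd_deg_odd_edges:
  assumes "walk V E ends u es w"
  shows "odd (deg ends (odd_edges es) v) \<longleftrightarrow> (u = v) \<noteq> (w = v)"
  using assms
proof (induction rule: walk.induct)
  case (Cons e u w es t)
  have "deg ends {e} v = of_bool (u = v) + of_bool (w = v)"
    using deg_insert[of "{}" e ends v] incidence_eq[of ends e u w v] Cons by simp
  then show ?case using Cons by (auto simp: even_deg_symdiff)
qed auto

lemma walk_positions:
  assumes "walk V E ends u es v"
  obtains p where "p 0 = u" "p (length es) = v"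
    "\<And>i. i < length es \<Longrightarrow> ends (es ! i) = {p i, p (Suc i)}" "\<And>i. i \<le> length es \<Longrightarrow> p i \<in> V"
proof -
  have "\<exists>p. p 0 = u \<and> p (length es) = v \<and>
    (\<forall>i<length es. ends (es ! i) = {p i, p (Suc i)}) \<and> (\<forall>i\<le>length es. p i \<in> V)"
    using assms
  proof (induction rule: walk.induct)
    case (Nil u)
    then show ?case by (intro exI[of _ "\<lambda>_. u"]) auto
  next
    case (Cons e u w es v)
    then obtain p where "p 0 = w" "p (length es) = v"
      "\<forall>i<length es. ends (es ! i) = {p i, p (Suc i)}" "\<forall>i\<le>length es. p i \<in> V" by blast
    with Cons show ?case
      by (intro exI[of _ "case_nat u p"]) (auto simp: nth_Cons split: nat.splits)
  qed
  then show ?thesis using that by blast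
qed

lemma walk_between:
  assumes "\<And>l. l < length es \<Longrightarrow> ends (es ! l) = {p l, p (Suc l)}"
    and "\<And>l. l \<le> length es \<Longrightarrow> p l \<in> V" and "set es \<subseteq> E"
    and "i \<le> j" "j \<le> length es"
  shows "walk V E ends (p i) (take (j - i) (drop i es)) (p j)"
  using assms(4,5)
proof (induction j rule: dec_induct)
  case base
  then show ?case using assms(2) by (auto intro: walk.Nil)
next
  case (step m)
  have "walk V E ends (p m) [es ! m] (p (Suc m))"
    using step assms by (intro walk_single) auto
  moreover have "take (Suc m - i) (drop i es) = take (m - i) (drop i es) @ [es ! m]"
    using step by (simp add: Suc_diff_le take_Suc_conv_app_nth)
  ultimately show ?case using step walk_append by fastforce
qed

text \<open>Every visit to \<open>v\<close> is left by one edge and entered by another, except that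
  position \<open>0\<close> is only left and position \<open>n\<close> only entered. The correction
  for position \<open>0\<close> stands on the left to avoid subtraction on naturals.\<close>

lemma deg_trail:
  assumes "distinct es" "\<And>l. l < length es \<Longrightarrow> ends (es ! l) = {p l, p (Suc l)}"
    and "n \<le> length es"
  shows "deg ends (set (take n es)) v + of_bool (p 0 = v) =
    2 * card {l. l < n \<and> p l = v} + of_bool (p n = v)"
  using assms(3)
proof (induction n)
  case (Suc n)
  have "es ! n \<notin> set (take n es)"
    using Suc assms(1) by (auto simp: in_set_conv_nth nth_eq_iff_index_eq)
  moreover have "set (take (Suc n) es) = insert (es ! n) (set (take n es))"
    using Suc by (simp add: take_Suc_conv_app_nth)
  ultimately have "deg ends (set (take (Suc n) es)) v =
      deg ends (set (take n es)) v + of_bool (p n = v) + of_bool (p (Suc n) = v)"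
    using incidence_eq[of ends "es ! n" "p n" "p (Suc n)" v] assms(2)[of n] Suc
    by (simp add: deg_insert)
  moreover have "{l. l < Suc n \<and> p l = v} =
      (if p n = v then insert n {l. l < n \<and> p l = v} else {l. l < n \<and> p l = v})"
    by (auto simp: less_Suc_eq)
  ultimately show ?case using Suc by auto
qed simp

section \<open>Cycles as minimal nonempty even edge sets\<close>

locale finite_graph =
  fixes V :: "'a set" and E :: "'e set" and ends :: "'e \<Rightarrow> 'a set"
  assumes graph: "graph V E ends"
begin

text \<open>These are the elements of the cycle space over the two-element field, with
  \<open>symdiff\<close> as addition.\<close>

definition even_set :: "'e set \<Rightarrow> bool" where
  "even_set F \<longleftrightarrow> F \<subseteq> E \<and> (\<forall>v. even (deg ends F v))"

lemma finite_E: "finite E"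
  using graph by (simp add: graph_def)

lemma finite_edges: "F \<subseteq> E \<Longrightarrow> finite F"
  using finite_E finite_subset by blast

lemma even_set_subset: "even_set F \<Longrightarrow> F \<subseteq> E"
  by (simp add: even_set_def)

lemma even_set_finite: "even_set F \<Longrightarrow> finite F"
  using even_set_subset finite_edges by blast

lemma ends_nonempty: "e \<in> E \<Longrightarrow> ends e \<noteq> {}"
  using graph by (fastforce simp: graph_def)

lemma edge_ends: "e \<in> E \<Longrightarrow> v \<in> ends e \<Longrightarrow> \<exists>w. ends e = {v, w} \<and> w \<in> V"
  using graph unfolding graph_def card_1_singleton_iff card_2_iff One_nat_def by fastforce

lemma verts_subset: "F \<subseteq> E \<Longrightarrow> verts ends F \<subseteq> V"
  using graph by (auto simp: graph_def verts_def)

lemma even_set_symdiff: "even_set A \<Longrightarrow> even_set B \<Longrightarrow> even_set (symdiff A B)"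
  using even_deg_symdiff[OF even_set_finite even_set_finite, of A B ends]
  by (simp add: even_set_def) (auto simp: symdiff_def)

lemma closed_walk_even_set:
  assumes "walk V E ends u es u" shows "even_set (odd_edges es)"
  using odd_deg_odd_edges[OF assms] walk_edges[OF assms] odd_edges_subset[of es]
  by (auto simp: even_set_def)

lemma cycle_even_set:
  assumes "is_cycle V E ends C" shows "even_set C"
proof -
  have "finite C" using assms finite_edges by (auto simp: is_cycle_def)
  have "even (deg ends C v)" for v
    using assms deg_pos_iff[OF \<open>finite C\<close>, of ends v] by (cases "v \<in> verts ends C") (auto simp: is_cycle_def)
  then show ?thesis using assms by (auto simp: even_set_def is_cycle_def)
qed

text \<open>At a vertex covered by \<open>Z\<close> the degree in \<open>Z\<close> is positive, even
  and at most 2, so \<open>Z\<close> contains all edges of \<open>C\<close> there. Connectedness of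
  \<open>C\<close> spreads this to the whole cycle.\<close>

lemma cycle_minimal_even_set:
  assumes C: "is_cycle V E ends C" and Z: "even_set Z" "Z \<noteq> {}" "Z \<subseteq> C"
  shows "Z = C"
proof -
  have finC: "finite C" and finZ: "finite Z"
    using even_set_finite[OF cycle_even_set[OF C]] even_set_finite[OF Z(1)] by auto
  have closed: "e \<in> Z" if "v \<in> verts ends Z" "e \<in> C" "v \<in> ends e" for v e
  proof (rule ccontr)
    assume "e \<notin> Z"
    then have "deg ends Z v + 1 \<le> deg ends (insert e Z) v"
      using deg_insert[OF finZ, of e ends v] that by simp
    also have "\<dots> \<le> deg ends C v" using that Z finC by (intro deg_mono) auto
    also have "\<dots> = 2"
      using that C Z by (auto simp: is_cycle_def verts_def)
    finally have "deg ends Z v \<le> 1" by simp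
    moreover have "even (deg ends Z v)" using Z by (simp add: even_set_def)
    moreover have "0 < deg ends Z v" using that deg_pos_iff[OF finZ, of ends v] by simp
    ultimately show False by (metis One_nat_def Suc_leI le_antisym odd_one)
  qed
  have reach: "v \<in> verts ends Z" if "walk (verts ends C) C ends u es v" "u \<in> verts ends Z" for u es v
    using that
  proof (induction rule: walk.induct)
    case (Cons e u w es v)
    then have "e \<in> Z" using closed by auto
    then have "w \<in> verts ends Z" using Cons by (auto simp: verts_def)
    then show ?case using Cons by simp
  qed
  obtain e where "e \<in> Z" using Z by auto
  then obtain u where u: "u \<in> verts ends Z"
    using even_set_subset[OF Z(1)] ends_nonempty by (fastforce simp: verts_def)
  have "e \<in> Z" if "e \<in> C" for e
  proof -
    have "e \<in> E" using that C by (auto simp: is_cycle_def)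
    then obtain v where v: "v \<in> ends e" using ends_nonempty by blast
    then have "v \<in> verts ends C" using that by (auto simp: verts_def)
    moreover have "u \<in> verts ends C" using u Z by (auto simp: verts_def)
    ultimately obtain es where "walk (verts ends C) C ends u es v"
      using C unfolding is_cycle_def connected_graph_def by blast
    then show ?thesis using reach u v that closed by blast
  qed
  then show ?thesis using Z by auto
qed

text \<open>A longest trail from \<open>u\<close> has used up all edges of \<open>F\<close> at its
  last vertex. If that vertex were not \<open>u\<close>, its degree in \<open>F\<close> would be
  odd.\<close>

lemma closed_trail_in_even_set:
  assumes F: "even_set F" and u: "u \<in> verts ends F"
  obtains es where "walk V F ends u es u" "distinct es" "es \<noteq> []"
proof -
  have finF: "finite F" using even_set_finite[OF F] .
  have FE: "F \<subseteq> E" using even_set_subset[OF F] .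
  let ?Q = "\<lambda>es. \<exists>v. walk V F ends u es v \<and> distinct es"
  have extend: "\<exists>es'. ?Q es' \<and> length es' = Suc (length es)"
    if w: "walk V F ends u es v" "distinct es" "v \<in> ends e" "e \<in> F" "e \<notin> set es" for es v e
  proof -
    obtain w where w': "ends e = {v, w}" "w \<in> V" using edge_ends w FE by blast
    then have "walk V F ends v [e] w"
      using w walk_end by (intro walk_single) auto
    then have "walk V F ends u (es @ [e]) w" using w walk_append by fast
    then show ?thesis using w by (intro exI[of _ "es @ [e]"]) auto
  qed
  have bound: "length es \<le> card F" if "?Q es" for es
    using that walk_edges[of V F ends u es] finF by (metis card_mono distinct_card)
  have "u \<in> V" using u verts_subset FE by auto
  then have Q0: "?Q []" by (auto intro: walk.Nil)
  define es where "es = (ARG_MAX length es. ?Q es)"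
  have es: "?Q es" "\<And>es'. ?Q es' \<Longrightarrow> length es' \<le> length es"
    using arg_max_nat_lemma[of ?Q "[]" length "card F + 1"] Q0 bound unfolding es_def by (auto simp: less_Suc_eq_le)
  then obtain v where v: "walk V F ends u es v" "distinct es" by blast
  have maximal: "e \<in> set es" if "v \<in> ends e" "e \<in> F" for e
    using extend[OF v] that es(2) by fastforce
  have "v = u"
  proof (rule ccontr)
    assume "v \<noteq> u"
    then have "odd (deg ends (set es) v)"
      using odd_deg_odd_edges[OF v(1)] odd_edges_distinct[OF v(2)] by metis
    moreover have "deg ends (set es) v = deg ends F v"
    proof -
      have "{e \<in> set es. v \<in> ends e} = {e \<in> F. v \<in> ends e}"
        "{e \<in> set es. ends e = {v}} = {e \<in> F. ends e = {v}}"
        using maximal walk_edges[OF v(1)] by auto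
      then show ?thesis by (simp add: deg_def)
    qed
    ultimately show False using F by (simp add: even_set_def)
  qed
  moreover have "es \<noteq> []" using maximal u \<open>v = u\<close> by (auto simp: verts_def)
  ultimately show ?thesis using that v by blast
qed

text \<open>A repeated vertex would cut off a shorter closed trail. That piece may start elsewhere,
  so \<open>short\<close> ranges over all base vertices \<open>v\<close>. Without repetitions
  \<open>deg_trail\<close> gives degree 2 everywhere.\<close>

lemma closed_trail_shortest_is_cycle:
  assumes w: "walk V F ends u es u" and d: "distinct es" and ne: "es \<noteq> []" and F: "F \<subseteq> E"
    and short: "\<And>v es'. walk V F ends v es' v \<Longrightarrow> distinct es' \<Longrightarrow> es' \<noteq> [] \<Longrightarrow> length es \<le> length es'"
  shows "is_cycle V E ends (set es)"
proof -
  obtain p where p: "p 0 = u" "p (length es) = u"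
    "\<And>i. i < length es \<Longrightarrow> ends (es ! i) = {p i, p (Suc i)}" "\<And>i. i \<le> length es \<Longrightarrow> p i \<in> V"
    using walk_positions[OF w] by metis
  have esF: "set es \<subseteq> F" using walk_edges[OF w] .
  have inj: "p i \<noteq> p j" if "i < j" "j < length es" for i j
  proof
    assume "p i = p j"
    then have "walk V F ends (p i) (take (j - i) (drop i es)) (p i)"
      using walk_between[of es ends p V F i j] p esF that by auto
    from short[OF this] d that show False by auto
  qed
  have deg2: "deg ends (set es) v = 2" if v: "v \<in> verts ends (set es)" for v
  proof -
    have *: "deg ends (set es) v = 2 * card {l. l < length es \<and> p l = v}"
      using deg_trail[of es ends p "length es" v] d p by simp
    have "i = j" if "i \<in> {l. l < length es \<and> p l = v}" "j \<in> {l. l < length es \<and> p l = v}" for i j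
      using inj[of i j] inj[of j i] that by (cases i j rule: linorder_cases) auto
    then have "card {l. l < length es \<and> p l = v} \<le> 1"
      by (intro card_le_Suc0_iff_eq[THEN iffD2, folded One_nat_def]) auto
    moreover have "0 < deg ends (set es) v" using v by (simp add: deg_pos_iff)
    ultimately show ?thesis using * by presburger
  qed
  let ?W = "verts ends (set es)"
  have pos: "\<exists>i\<le>length es. p i = v" if "v \<in> ?W" for v
  proof -
    from that obtain l where l: "l < length es" "v \<in> ends (es ! l)"
      by (auto simp: verts_def in_set_conv_nth)
    then have "v = p l \<or> v = p (Suc l)" using p(3) by auto
    with l show ?thesis by (metis Suc_leI less_imp_le)
  qed
  have conn': "\<exists>es'. walk ?W (set es) ends (p i) es' (p j)"
    if "i \<le> j" "j \<le> length es" "p i \<in> ?W" for i j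
  proof -
    have "walk V (set es) ends (p i) (take (j - i) (drop i es)) (p j)"
      using walk_between[of es ends p V "set es" i j] p that by auto
    from walk_transfer[OF this, of "set es" ?W] that walk_edges[OF this] show ?thesis by blast
  qed
  have "\<exists>es'. walk ?W (set es) ends v es' w" if vw: "v \<in> ?W" "w \<in> ?W" for v w
  proof -
    obtain i j where "i \<le> length es" "p i = v" "j \<le> length es" "p j = w"
      using pos[OF vw(1)] pos[OF vw(2)] by blast
    then show ?thesis
      using conn'[of i j] conn'[of j i] vw walk_rev by (metis nat_le_linear)
  qed
  then show ?thesis
    using deg2 ne esF F by (auto simp: is_cycle_def connected_graph_def)
qed

lemma even_set_contains_cycle:
  assumes F: "even_set F" "F \<noteq> {}"
  obtains Z where "is_cycle V E ends Z" "Z \<subseteq> F"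
proof -
  have FE: "F \<subseteq> E" using even_set_subset F by auto
  let ?Q = "\<lambda>es. \<exists>v. walk V F ends v es v \<and> distinct es \<and> es \<noteq> []"
  obtain e where e: "e \<in> F" using F by auto
  then have "ends e \<noteq> {}" using FE ends_nonempty by auto
  then obtain u where "u \<in> verts ends F" using e by (auto simp: verts_def)
  then have "\<exists>es. ?Q es" using closed_trail_in_even_set[OF F(1)] by metis
  then obtain es where es: "?Q es" "\<And>es'. ?Q es' \<Longrightarrow> length es \<le> length es'"
    using ex_has_least_nat[of ?Q _ length] by blast
  then obtain v where v: "walk V F ends v es v" "distinct es" "es \<noteq> []" by blast
  have "is_cycle V E ends (set es)"
  proof (rule closed_trail_shortest_is_cycle[OF v FE])
    fix w es' assume "walk V F ends w es' w" "distinct es'" "es' \<noteq> []"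
    then show "length es \<le> length es'" by (intro es(2)) auto
  qed
  moreover have "set es \<subseteq> F" using walk_edges[OF v(1)] .
  ultimately show ?thesis using that by blast
qed

lemma cycle_closed_trail:
  assumes C: "is_cycle V E ends C" and x: "x \<in> verts ends C"
  obtains es where "walk V E ends x es x" "distinct es" "set es = C"
proof -
  obtain es where es: "walk V C ends x es x" "distinct es" "es \<noteq> []"
    using closed_trail_in_even_set[OF cycle_even_set[OF C] x] .
  have sub: "set es \<subseteq> C" "C \<subseteq> E" using walk_edges[OF es(1)] C by (auto simp: is_cycle_def)
  then have w: "walk V E ends x es x"
    using walk_transfer[OF es(1), of E V] verts_subset walk_start[OF es(1)] by auto
  have "even_set (set es)"
    using closed_walk_even_set[OF w] odd_edges_distinct[OF es(2)] by simp
  then have "set es = C" using cycle_minimal_even_set[OF C] sub es by auto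
  then show ?thesis using that w es by blast
qed

end

section \<open>Fundamental cycles of a breadth-first-search tree\<close>

locale bfs_graph = finite_graph V E ends
  for V :: "'a set" and E :: "'e set" and ends :: "'e \<Rightarrow> 'a set" +
  fixes x :: 'a and T :: "'e set"
  assumes root: "x \<in> V" and bfs_tree: "bfs_tree V E ends x T"
begin

abbreviation d :: "'a \<Rightarrow> nat" where
  "d \<equiv> gdist V E ends x"

lemma tree_subset: "T \<subseteq> E"
  using bfs_tree by (simp add: bfs_tree_def spanning_tree_def)

lemma tree_walk:
  assumes "v \<in> V"
  obtains ts where "walk V E ends x ts v" "set ts \<subseteq> T" "length ts = d v"
proof -
  have "\<exists>es. walk V T ends x es v"
    using bfs_tree root assms by (simp add: bfs_tree_def spanning_tree_def connected_graph_def)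
  then have "\<exists>n es. walk V T ends x es v \<and> length es = n" by blast
  from LeastI_ex[OF this] obtain ts where ts: "walk V T ends x ts v" "length ts = gdist V T ends x v"
    unfolding gdist_def by blast
  have "walk V E ends x ts v"
    using walk_transfer[OF ts(1), of E V] walk_edges[OF ts(1)] tree_subset root verts_subset[of E]
    by simp
  moreover have "length ts = d v" using ts bfs_tree assms by (simp add: bfs_tree_def)
  ultimately show ?thesis using that walk_edges[OF ts(1)] by simp
qed

lemma dist_le: "walk V E ends x es v \<Longrightarrow> d v \<le> length es"
  unfolding gdist_def by (rule Least_le) blast

lemma dist_root: "d x = 0"
  using dist_le[OF walk.Nil[OF root]] by simp

lemma dist_step:
  assumes "e \<in> E" "ends e = {u, w}"
  shows "d w \<le> Suc (d u)"
proof -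
  have V: "u \<in> V" "w \<in> V" using assms graph by (auto simp: graph_def)
  obtain ts where ts: "walk V E ends x ts u" "length ts = d u" using tree_walk V by metis
  have "walk V E ends x (ts @ [e]) w"
    using walk_append[OF ts(1) walk_single] assms V by metis
  from dist_le[OF this] show ?thesis using ts by simp
qed

lemma even_set_in_tree:
  assumes "even_set Z" "Z \<subseteq> T" shows "Z = {}"
proof (rule ccontr)
  assume "Z \<noteq> {}"
  then obtain C where "is_cycle V E ends C" "C \<subseteq> Z"
    using even_set_contains_cycle assms by metis
  then have "is_cycle V T ends C" using assms by (auto simp: is_cycle_def)
  then show False using bfs_tree by (auto simp: bfs_tree_def spanning_tree_def)
qed

text \<open>The symmetric difference is an even set inside the tree, hence empty. All later
  identifications of even sets compare non-tree edges only.\<close>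

lemma even_set_eqI:
  assumes "even_set A" "even_set B" "A - T = B - T"
  shows "A = B"
proof -
  have "symdiff A B - T = {}" using assms(3) unfolding symdiff_Diff by (simp add: symdiff_def)
  then have "symdiff A B = {}" using even_set_in_tree even_set_symdiff[OF assms(1,2)] by simp
  then show ?thesis by (auto simp: symdiff_def)
qed

text \<open>Tree paths from \<open>x\<close> to \<open>u\<close> and \<open>v\<close> close the walk
  without affecting non-tree edges. Cancellation can only shrink the length, and it keeps its
  parity.\<close>

lemma close_up_walk:
  assumes "walk V E ends u es v"
  obtains F where "even_set F" "F - T = odd_edges es - T" "card F \<le> d u + length es + d v"
    "even (card F) \<longleftrightarrow> even (d u + length es + d v)"
proof -
  obtain us where us: "walk V E ends x us u" "set us \<subseteq> T" "length us = d u"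
    using tree_walk walk_start[OF assms] by metis
  obtain vs where vs: "walk V E ends x vs v" "set vs \<subseteq> T" "length vs = d v"
    using tree_walk walk_end[OF assms] by metis
  let ?ws = "us @ es @ rev vs"
  have "walk V E ends x ?ws x"
    using us vs assms walk_append walk_rev by metis
  then have "even_set (odd_edges ?ws)" by (rule closed_walk_even_set)
  moreover have "odd_edges ?ws - T = odd_edges es - T"
    using odd_edges_subset[of us] odd_edges_subset[of "rev vs"] us vs
    unfolding odd_edges_append symdiff_def by auto
  moreover have "length ?ws = d u + length es + d v" using us vs by simp
  ultimately show ?thesis
    using that card_odd_edges_le[of ?ws] even_card_odd_edges[of ?ws] by metis
qed

text \<open>Uniqueness comes from \<open>even_set_eqI\<close>, existence for non-tree edges from
  \<open>fc_walk\<close>. Characterising the set by its non-tree part postpones the proof that it is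
  a cycle.\<close>

definition fc :: "'e \<Rightarrow> 'e set" where
  "fc e = (THE F. even_set F \<and> F - T = {e})"

lemma fcI:
  assumes "even_set F" "F - T = {e}" shows "fc e = F"
  unfolding fc_def
proof (rule the_equality)
  fix F' assume "even_set F' \<and> F' - T = {e}"
  then show "F' = F" using even_set_eqI[of F' F] assms by simp
qed (use assms in simp)

lemma fc_walk:
  assumes "e \<in> E - T" "ends e = {u, w}"
  shows "even_set (fc e)" "fc e - T = {e}" "card (fc e) \<le> Suc (d u + d w)"
    "even (card (fc e)) \<longleftrightarrow> odd (d u + d w)"
proof -
  have "walk V E ends u [e] w"
    using assms graph by (intro walk_single) (auto simp: graph_def)
  then obtain F where F: "even_set F" "F - T = odd_edges [e] - T" "card F \<le> d u + length [e] + d w"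
    "even (card F) \<longleftrightarrow> even (d u + length [e] + d w)"
    by (rule close_up_walk)
  have "F - T = {e}" using F assms by (auto simp: symdiff_def)
  with F show "even_set (fc e)" "fc e - T = {e}" "card (fc e) \<le> Suc (d u + d w)"
    "even (card (fc e)) \<longleftrightarrow> odd (d u + d w)"
    using fcI[of F e] by auto
qed

lemma fc:
  assumes "e \<in> E - T" shows "even_set (fc e)" "fc e - T = {e}"
proof -
  obtain v where "v \<in> ends e" using assms ends_nonempty by blast
  then obtain w where "ends e = {v, w}" using edge_ends assms by blast
  then show "even_set (fc e)" "fc e - T = {e}" using fc_walk[OF assms] by simp_all
qed

lemma finite_fc: "e \<in> E - T \<Longrightarrow> finite (fc e)"
  by (rule even_set_finite[OF fc(1)])

text \<open>A cycle inside \<open>fc e\<close> cannot lie in the tree, so it contains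
  \<open>e\<close> and equals \<open>fc e\<close> by uniqueness.\<close>

lemma fc_cycle:
  assumes "e \<in> E - T" shows "is_cycle V E ends (fc e)"
proof -
  have "fc e \<noteq> {}" using fc[OF assms] by auto
  then obtain Z where Z: "is_cycle V E ends Z" "Z \<subseteq> fc e"
    using even_set_contains_cycle fc[OF assms] by metis
  have "Z \<noteq> {}" using Z by (auto simp: is_cycle_def)
  then have "\<not> Z \<subseteq> T" using even_set_in_tree cycle_even_set[OF Z(1)] by blast
  moreover have "Z - T \<subseteq> {e}" using Diff_mono[OF Z(2) order_refl] fc(2)[OF assms] by metis
  ultimately have "Z - T = {e}" by blast
  then have "fc e = Z" by (rule fcI[OF cycle_even_set[OF Z(1)]])
  then show ?thesis using Z by simp
qed

lemma fc_in_fundamental_cycles: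
  assumes "e \<in> E - T" shows "fc e \<in> fundamental_cycles V E ends T"
proof -
  have "fc e \<subseteq> insert e T" using equalityD1[OF fc(2)[OF assms]] by blast
  then show ?thesis using fc_cycle[OF assms] assms unfolding fundamental_cycles_def by blast
qed

lemma symdiff_fc:
  assumes "e \<in> E - T" "f \<in> E - T" "e \<noteq> f"
  shows "even_set (symdiff (fc e) (fc f))" "symdiff (fc e) (fc f) - T = {e, f}"
proof -
  show "even_set (symdiff (fc e) (fc f))"
    using even_set_symdiff[OF fc(1)[OF assms(1)] fc(1)[OF assms(2)]] .
  show "symdiff (fc e) (fc f) - T = {e, f}"
    unfolding symdiff_Diff fc(2)[OF assms(1)] fc(2)[OF assms(2)]
    using assms(3) by (auto simp: symdiff_def)
qed

text \<open>A cycle \<open>Z\<close> inside the symmetric difference has one or both of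
  \<open>e\<close>, \<open>f\<close> as non-tree edges. With only one, \<open>Z\<close> would be
  \<open>fc e\<close> or \<open>fc f\<close>, which contains the shared edge that the symmetric
  difference omits.\<close>

lemma symdiff_fc_cycle:
  assumes e: "e \<in> E - T" and f: "f \<in> E - T" and ef: "e \<noteq> f" and meet: "fc e \<inter> fc f \<noteq> {}"
  shows "is_cycle V E ends (symdiff (fc e) (fc f))"
proof -
  let ?D = "symdiff (fc e) (fc f)"
  note D = symdiff_fc[OF e f ef]
  have "?D \<noteq> {}" using D by auto
  then obtain Z where Z: "is_cycle V E ends Z" "Z \<subseteq> ?D"
    using even_set_contains_cycle D by metis
  note Zeven = cycle_even_set[OF Z(1)]
  have "Z \<noteq> {}" using Z by (auto simp: is_cycle_def)
  then have "\<not> Z \<subseteq> T" using even_set_in_tree Zeven by blast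
  moreover have "Z - T \<subseteq> {e, f}" using Diff_mono[OF Z(2) order_refl] D(2) by metis
  ultimately consider "Z - T = {e}" | "Z - T = {f}" | "Z - T = {e, f}" by blast
  then have "Z = ?D"
  proof cases
    case 1
    then have "fc e \<subseteq> ?D" using fcI[OF Zeven] Z by simp
    then show ?thesis using meet by (auto simp: symdiff_def)
  next
    case 2
    then have "fc f \<subseteq> ?D" using fcI[OF Zeven] Z by simp
    then show ?thesis using meet by (auto simp: symdiff_def)
  next
    case 3
    then show ?thesis using even_set_eqI[OF Zeven D(1)] D(2) by simp
  qed
  then show ?thesis using Z by simp
qed

text \<open>An even set is the sum of the fundamental cycles of its non-tree edges. The induction
  strips the summands other than \<open>fc f\<close>; being disjoint from \<open>fc f\<close>, they
  cancel none of its edges.\<close>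

lemma disjoint_fc_subset:
  assumes "even_set F" "f \<in> F - T" "\<And>g. g \<in> F - T \<Longrightarrow> g \<noteq> f \<Longrightarrow> fc f \<inter> fc g = {}"
  shows "fc f \<subseteq> F"
  using assms
proof (induction "card (F - T)" arbitrary: F rule: less_induct)
  case less
  show ?case
  proof (cases "F - T = {f}")
    case True
    then show ?thesis using fcI[OF less.prems(1)] by simp
  next
    case False
    then obtain g where g: "g \<in> F - T" "g \<noteq> f" using less.prems(2) by blast
    then have gE: "g \<in> E - T" using even_set_subset[OF less.prems(1)] by blast
    let ?F = "symdiff F (fc g)"
    have FT: "?F - T = (F - T) - {g}"
      unfolding symdiff_Diff fc(2)[OF gE] using g by (auto simp: symdiff_def)
    have "finite (F - T)" using even_set_finite[OF less.prems(1)] by simp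
    then have "card (?F - T) < card (F - T)" unfolding FT using g by (intro card_Diff1_less) auto
    moreover have "even_set ?F" using even_set_symdiff[OF less.prems(1) fc(1)[OF gE]] .
    ultimately have "fc f \<subseteq> ?F"
      by (rule less.hyps) (use FT g less.prems in auto)
    moreover have "fc f \<inter> fc g = {}" using less.prems(3)[OF g] .
    ultimately show ?thesis by (auto simp: symdiff_def)
  qed
qed

end

section \<open>Cycles through the root\<close>

text \<open>The cycle is cut open at the root: edge \<open>es ! i\<close> joins \<open>p i\<close>
  to \<open>p (Suc i)\<close>, and positions \<open>0\<close> and \<open>length es\<close> are both
  \<open>x\<close>, so distances can be bounded from either end.\<close>

locale rooted_cycle = bfs_graph V E ends x T
  for V :: "'a set" and E :: "'e set" and ends :: "'e \<Rightarrow> 'a set" and x T +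
  fixes C :: "'e set" and es :: "'e list" and p :: "nat \<Rightarrow> 'a"
  assumes cycle: "is_cycle V E ends C"
    and trail: "distinct es" "set es = C"
    and closed: "p 0 = x" "p (length es) = x"
    and step: "\<And>i. i < length es \<Longrightarrow> ends (es ! i) = {p i, p (Suc i)}"
    and pos_V: "\<And>i. i \<le> length es \<Longrightarrow> p i \<in> V"
begin

section \<open>Distances from the root along the cycle\<close>

lemma cycle_subset: "C \<subseteq> E"
  using cycle by (simp add: is_cycle_def)

lemma length_trail: "length es = card C"
  using trail distinct_card by fastforce

lemma nth_in_E: "i < card C \<Longrightarrow> es ! i \<in> E"
  using cycle_subset trail length_trail nth_mem by fastforce

lemma dist_Suc:
  assumes "i < card C"
  shows "d (p (Suc i)) \<le> Suc (d (p i))" "d (p i) \<le> Suc (d (p (Suc i)))"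
proof -
  have "ends (es ! i) = {p i, p (Suc i)}" using step assms length_trail by simp
  then show "d (p (Suc i)) \<le> Suc (d (p i))" "d (p i) \<le> Suc (d (p (Suc i)))"
    using dist_step[OF nth_in_E[OF assms], of "p i" "p (Suc i)"]
      dist_step[OF nth_in_E[OF assms], of "p (Suc i)" "p i"] by (simp_all add: insert_commute)
qed

lemma dist_lipschitz:
  assumes "i \<le> j" "j \<le> card C"
  shows "d (p j) \<le> d (p i) + (j - i)" "d (p i) \<le> d (p j) + (j - i)"
proof -
  have "d (p j) \<le> d (p i) + (j - i) \<and> d (p i) \<le> d (p j) + (j - i)"
    using assms
  proof (induction j rule: dec_induct)
    case (step m)
    then show ?case using dist_Suc[of m] by auto
  qed simp
  then show "d (p j) \<le> d (p i) + (j - i)" "d (p i) \<le> d (p j) + (j - i)" by auto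
qed

lemma dist_pos_le:
  assumes "i \<le> card C" shows "d (p i) \<le> i" "d (p i) \<le> card C - i"
  using dist_lipschitz(1)[of 0 i] dist_lipschitz(2)[of i "card C"] assms closed dist_root
  unfolding length_trail by simp_all

lemma nontree_index:
  assumes "e \<in> C - T" obtains i where "i < card C" "es ! i = e" "e \<in> E - T"
proof -
  have "e \<in> set es" using assms trail(2) by simp
  then obtain i where "i < length es" "es ! i = e" by (auto simp: in_set_conv_nth)
  moreover have "e \<in> E - T" using assms cycle_subset by blast
  ultimately show ?thesis using that length_trail by simp
qed

lemma fc_nth:
  assumes "i < card C" "es ! i \<notin> T"
  shows "card (fc (es ! i)) \<le> Suc (d (p i) + d (p (Suc i)))"
    "even (card (fc (es ! i))) \<longleftrightarrow> odd (d (p i) + d (p (Suc i)))"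
proof -
  have "es ! i \<in> E - T" "ends (es ! i) = {p i, p (Suc i)}"
    using step assms nth_in_E length_trail by simp_all
  from fc_walk(3,4)[OF this] show "card (fc (es ! i)) \<le> Suc (d (p i) + d (p (Suc i)))"
    "even (card (fc (es ! i))) \<longleftrightarrow> odd (d (p i) + d (p (Suc i)))" .
qed

text \<open>For \<open>e = es ! i\<close>, bounding \<open>d (p i)\<close> by the initial arc and
  \<open>d (p (Suc i))\<close> by the final arc gives
  \<open>i + 1 + (card C - Suc i)\<close>.\<close>

lemma card_fc_le:
  assumes "e \<in> C - T" shows "card (fc e) \<le> card C"
proof -
  obtain i where i: "i < card C" "es ! i = e" using nontree_index assms by metis
  then show ?thesis
    using fc_nth(1)[of i] dist_pos_le(1)[of i] dist_pos_le(2)[of "Suc i"] assms by auto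
qed

lemma cycle_minus_tree_nonempty: "C - T \<noteq> {}"
  using cycle even_set_in_tree[OF cycle_even_set[OF cycle]]
  unfolding is_cycle_def Diff_eq_empty_iff by blast

lemma cycle_eq_fc: "C - T = {e} \<Longrightarrow> C = fc e"
  using fcI[OF cycle_even_set[OF cycle]] by simp

lemma cycle_eq_symdiff_fc:
  assumes "C - T = {e, f}" "e \<noteq> f" shows "C = symdiff (fc e) (fc f)"
proof -
  have "e \<in> C - T" "f \<in> C - T" unfolding assms(1) by simp_all
  then have ef: "e \<in> E - T" "f \<in> E - T" using cycle_subset by blast+
  show ?thesis
    using even_set_eqI[OF cycle_even_set[OF cycle] symdiff_fc(1)[OF ef assms(2)]]
      symdiff_fc(2)[OF ef assms(2)] assms(1) by simp
qed

text \<open>The order is linear, not cyclic: the last and the first non-tree edge are separated by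
  the root.\<close>

definition consecutive :: "nat \<Rightarrow> nat \<Rightarrow> bool" where
  "consecutive i j \<longleftrightarrow> i < j \<and> j < card C \<and> es ! i \<notin> T \<and> es ! j \<notin> T \<and>
     (\<forall>l. i < l \<longrightarrow> l < j \<longrightarrow> es ! l \<in> T)"

lemma consecutiveD:
  assumes "consecutive i j"
  shows "es ! i \<in> E - T" "es ! j \<in> E - T" "es ! i \<noteq> es ! j" "i < j" "j < card C"
    "es ! i \<in> C - T" "es ! j \<in> C - T"
proof -
  show ij: "i < j" "j < card C" using assms by (simp_all add: consecutive_def)
  have T: "es ! i \<notin> T" "es ! j \<notin> T" using assms by (simp_all add: consecutive_def)
  then show "es ! i \<in> E - T" "es ! j \<in> E - T" using ij nth_in_E by simp_all
  show "es ! i \<noteq> es ! j" using ij trail(1) length_trail by (simp add: nth_eq_iff_index_eq)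
  show "es ! i \<in> C - T" "es ! j \<in> C - T"
    using T ij length_trail nth_mem[of i es] nth_mem[of j es] unfolding trail(2) by simp_all
qed

text \<open>The segment from edge \<open>i\<close> to edge \<open>j\<close>, both included, has
  \<open>Suc j - i\<close> edges, of which only these two are outside the tree. Closing it up
  therefore yields exactly the symmetric difference.\<close>

lemma card_symdiff_consecutive:
  assumes "consecutive i j"
  shows "card (symdiff (fc (es ! i)) (fc (es ! j))) \<le> d (p i) + (Suc j - i) + d (p (Suc j))"
proof -
  note c = consecutiveD[OF assms]
  let ?ws = "take (Suc j - i) (drop i es)"
  have "walk V E ends (p i) ?ws (p (Suc j))"
    using step pos_V cycle_subset trail c length_trail by (intro walk_between) auto
  then obtain F where F: "even_set F" "F - T = odd_edges ?ws - T"
    "card F \<le> d (p i) + length ?ws + d (p (Suc j))"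
    using close_up_walk by metis
  have "odd_edges ?ws = set ?ws" using trail by (simp add: odd_edges_distinct)
  also have "\<dots> = {es ! l | l. i \<le> l \<and> l \<le> j}"
  proof -
    have "?ws = map ((!) es) [i..<Suc j]"
      using c length_trail
      by (intro nth_equalityI) (simp_all del: upt_Suc)
    then show ?thesis by (auto simp del: upt_Suc)
  qed
  finally have "odd_edges ?ws - T = {es ! i, es ! j}"
    using assms unfolding consecutive_def by (auto simp: le_less)
  then have "F = symdiff (fc (es ! i)) (fc (es ! j))"
    using even_set_eqI F symdiff_fc[OF c(1,2,3)] by metis
  then show ?thesis using F c length_trail by auto
qed

lemma consecutive_neighbour:
  assumes "m < card C" "es ! m \<notin> T" "C - T \<noteq> {es ! m}"
  obtains i j where "consecutive i j" "m = i \<or> m = j"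
proof -
  let ?I = "{l. l < card C \<and> es ! l \<notin> T}"
  have "es ! m \<in> C - T" using assms trail length_trail by auto
  then obtain e where e: "e \<in> C - T" "e \<noteq> es ! m" using assms(3) by blast
  obtain l where "l < card C" "es ! l = e" by (rule nontree_index[OF e(1)])
  with e have l: "l \<in> ?I" "l \<noteq> m" by auto
  show ?thesis
  proof (cases "m < l")
    case True
    define j where "j = (LEAST j. m < j \<and> j \<in> ?I)"
    have "m < j \<and> j \<in> ?I" unfolding j_def by (rule LeastI[of _ l]) (use True l in auto)
    moreover have "l' \<notin> ?I" if "m < l'" "l' < j" for l'
      using not_less_Least[of l' "\<lambda>j. m < j \<and> j \<in> ?I"] that unfolding j_def by blast
    ultimately have "consecutive m j" using assms by (auto simp: consecutive_def)
    then show ?thesis using that by blast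
  next
    case False
    then have lm: "l < m" using l by auto
    define i where "i = (GREATEST i. i < m \<and> i \<in> ?I)"
    have "i < m \<and> i \<in> ?I" unfolding i_def
      by (rule GreatestI_nat[of _ l m]) (use lm l in auto)
    moreover have "l' \<notin> ?I" if "i < l'" "l' < m" for l'
    proof
      assume "l' \<in> ?I"
      then have "l' \<le> i" unfolding i_def using that by (intro Greatest_le_nat[of _ l' m]) auto
      then show False using that by simp
    qed
    ultimately have "consecutive i m" using assms by (auto simp: consecutive_def)
    then show ?thesis using that by blast
  qed
qed

text \<open>Let \<open>e\<close> maximise \<open>card (fc e)\<close> and let \<open>f\<close> be a neighbour of it. If their fundamental
  cycles are disjoint, then together they have at most \<open>card C\<close> edges; but \<open>fc f\<close> meets another
  \<open>fc g\<close>, and \<open>card (fc g) \<le> card (fc e)\<close> makes the cycle \<open>symdiff (fc f) (fc g)\<close> too short.\<close>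

lemma consecutive_meet:
  assumes even: "even (card {h \<in> C. P h})"
    and odd: "\<And>e. e \<in> C - T \<Longrightarrow> odd (card {h \<in> fc e. P h})"
    and min: "\<And>D. is_cycle V E ends D \<Longrightarrow> even (card {h \<in> D. P h}) \<Longrightarrow> card C \<le> card D"
  obtains i j where "consecutive i j" "fc (es ! i) \<inter> fc (es ! j) \<noteq> {}"
proof -
  have CE: "e \<in> E - T" if "e \<in> C - T" for e using that cycle_subset by blast
  have fin: "finite (C - T)" using cycle_subset finite_edges by blast
  obtain e where e: "e \<in> C - T" and max: "\<And>g. g \<in> C - T \<Longrightarrow> card (fc g) \<le> card (fc e)"
  proof -
    let ?M = "Max ((\<lambda>g. card (fc g)) ` (C - T))"
    have "?M \<in> (\<lambda>g. card (fc g)) ` (C - T)"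
      using fin cycle_minus_tree_nonempty by (intro Max_in) auto
    then obtain e where "e \<in> C - T" "card (fc e) = ?M" by auto
    then show ?thesis using that fin by simp
  qed
  obtain m where m: "m < card C" "es ! m = e" using nontree_index e by metis
  \<comment> \<open>Otherwise \<open>C\<close> would equal \<open>fc e\<close>, which has the wrong
    parity.\<close>
  have "C - T \<noteq> {e}" using cycle_eq_fc even odd e by metis
  then obtain i j where ij: "consecutive i j" "m = i \<or> m = j"
    using consecutive_neighbour[of m] m e by auto
  note c = consecutiveD[OF ij(1)]
  show ?thesis
  proof (cases "fc (es ! i) \<inter> fc (es ! j) = {}")
    case False
    then show ?thesis using that ij by blast
  next
    case True
    define f where "f = (if m = i then es ! j else es ! i)"
    have f: "f \<in> C - T" using c f_def by auto
    \<comment> \<open>Disjointness turns the size of the symmetric difference into a sum; the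
      initial arc, the segment and the final arc together have \<open>card C\<close> edges.\<close>
    have "card (fc (es ! i)) + card (fc (es ! j)) \<le> card C"
      using card_symdiff_consecutive[OF ij(1)] card_symdiff[of "fc (es ! i)" "fc (es ! j)"] True
        finite_fc c dist_pos_le(1)[of i] dist_pos_le(2)[of "Suc j"] by simp
    then have sum: "card (fc e) + card (fc f) \<le> card C"
      using ij m f_def by (auto split: if_splits)
    \<comment> \<open>If \<open>fc f\<close> met no other \<open>fc g\<close>, it would lie in
      \<open>C\<close> and hence equal it, against parity.\<close>
    obtain g where g: "g \<in> C - T" "g \<noteq> f" "fc f \<inter> fc g \<noteq> {}"
    proof (rule ccontr)
      assume "\<not> thesis"
      then have "fc f \<subseteq> C"
        using disjoint_fc_subset[OF cycle_even_set[OF cycle] f] that by blast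
      moreover have "fc f \<noteq> {}" using fc[OF CE[OF f]] by auto
      ultimately have "fc f = C"
        using cycle_minimal_even_set[OF cycle] fc[OF CE[OF f]] by blast
      then show False using odd[OF f] even by simp
    qed
    let ?D = "symdiff (fc f) (fc g)"
    have finf: "finite (fc f)" "finite (fc g)" using finite_fc CE f g by auto
    have "is_cycle V E ends ?D" using symdiff_fc_cycle CE f g by metis
    moreover have "even (card {h \<in> ?D. P h})"
      using even_card_Collect_symdiff[OF finf] odd f g by simp
    ultimately have "card C \<le> card ?D" using min by blast
    moreover have "0 < card (fc f \<inter> fc g)" using g finf by (simp add: card_gt_0_iff)
    moreover have "card (fc g) \<le> card (fc e)" using max g by blast
    ultimately show ?thesis using card_symdiff[OF finf] sum by simp
  qed
qed

text \<open>This serves part (a), with \<open>P\<close> selecting the edges of signature -1. Two odd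
  fundamental cycles have an even symmetric difference.\<close>

lemma minimal_parity_cycle:
  assumes even: "even (card {h \<in> C. P h})"
    and min: "\<And>D. is_cycle V E ends D \<Longrightarrow> even (card {h \<in> D. P h}) \<Longrightarrow> card C \<le> card D"
  obtains D where "D \<in> fundamental_cycles V E ends T \<or> is_cycle V E ends D \<and>
      (\<exists>A \<in> fundamental_cycles V E ends T. \<exists>B \<in> fundamental_cycles V E ends T. D = symdiff A B)"
    "even (card {h \<in> D. P h})" "card D \<le> card C"
proof (cases "\<exists>e \<in> C - T. even (card {h \<in> fc e. P h})")
  case True
  then obtain e where "e \<in> C - T" "even (card {h \<in> fc e. P h})" by blast
  then show ?thesis
    using that[of "fc e"] card_fc_le fc_in_fundamental_cycles cycle_subset by blast
next
  case False
  then obtain i j where ij: "consecutive i j" "fc (es ! i) \<inter> fc (es ! j) \<noteq> {}"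
    using consecutive_meet[of P] even min by blast
  note c = consecutiveD[OF ij(1)]
  let ?D = "symdiff (fc (es ! i)) (fc (es ! j))"
  have "is_cycle V E ends ?D" using symdiff_fc_cycle c ij by blast
  moreover have "even (card {h \<in> ?D. P h})"
    using even_card_Collect_symdiff[OF finite_fc finite_fc, OF c(1,2)] False c(6,7) by blast
  moreover have "card ?D \<le> card C"
    using card_symdiff_consecutive[OF ij(1)] dist_pos_le(1)[of i] dist_pos_le(2)[of "Suc j"] c
    by simp
  ultimately show ?thesis using that fc_in_fundamental_cycles c by blast
qed

text \<open>The bounds on \<open>d (p i)\<close> and \<open>d (p (Suc i))\<close> from both arcs sum
  to at least \<open>2 * k - 1\<close> only for the two edges at position \<open>k\<close>, and
  there the bound at \<open>p k\<close> must be attained.\<close>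

lemma even_fc_antipodal:
  assumes n: "card C = 2 * k" and i: "i < card C" "es ! i \<notin> T"
    and "card C \<le> card (fc (es ! i))"
  shows "i = k \<or> Suc i = k" "d (p k) = k"
proof -
  have "2 * k \<le> Suc (d (p i) + d (p (Suc i)))" using fc_nth(1)[OF i] assms by linarith
  moreover have "d (p i) \<le> i" "d (p i) \<le> 2 * k - i" "d (p (Suc i)) \<le> Suc i"
    "d (p (Suc i)) \<le> 2 * k - Suc i"
    using dist_pos_le[of i] dist_pos_le[of "Suc i"] i n by auto
  ultimately have "(i = k \<and> k \<le> d (p i)) \<or> (Suc i = k \<and> k \<le> d (p (Suc i)))"
    using i n by linarith
  moreover have "d (p k) \<le> k" using dist_pos_le(1)[of k] n by simp
  ultimately show "i = k \<or> Suc i = k" "d (p k) = k" by auto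
qed

lemma minimal_even_cycle:
  assumes even: "even (card C)"
    and min: "\<And>D. is_cycle V E ends D \<Longrightarrow> even (card D) \<Longrightarrow> card C \<le> card D"
  shows "C \<in> fundamental_cycles V E ends T \<or>
    (\<exists>A \<in> fundamental_cycles V E ends T. \<exists>B \<in> fundamental_cycles V E ends T. C = symdiff A B)"
proof -
  have small: ?thesis if sub: "C - T \<subseteq> {e, f}" for e f
  proof -
    have fund: "g \<in> C - T \<Longrightarrow> fc g \<in> fundamental_cycles V E ends T" for g
      using fc_in_fundamental_cycles cycle_subset by blast
    consider g where "C - T = {g}" | "C - T = {e, f}" "e \<noteq> f"
      using sub cycle_minus_tree_nonempty by blast
    then show ?thesis
    proof cases
      case 1
      then show ?thesis using cycle_eq_fc fund by (metis singletonI)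
    next
      case 2
      then show ?thesis using cycle_eq_symdiff_fc fund by (metis insertCI)
    qed
  qed
  obtain k where n: "card C = 2 * k" using even by (elim evenE)
  show ?thesis
  proof (cases "\<exists>e \<in> C - T. even (card (fc e))")
    case True
    then obtain e where e: "e \<in> C - T" "even (card (fc e))" by blast
    obtain i where i: "i < card C" "es ! i = e" "e \<in> E - T" by (rule nontree_index[OF e(1)])
    then have "card C \<le> card (fc e)" using min fc_cycle e by blast
    then have dk: "d (p k) = k" using even_fc_antipodal[OF n, of i] i by auto
    \<comment> \<open>A root distance of \<open>k\<close> at the antipode leaves no slack on either
      arc, so distances agree with those along \<open>C\<close>. The ends of each edge then differ
      in parity, making every fundamental cycle of \<open>C - T\<close> even.\<close>
    have dist: "d (p j) = (if j \<le> k then j else 2 * k - j)" if "j \<le> 2 * k" for j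
    proof (cases "j \<le> k")
      case True
      then show ?thesis using dist_pos_le(1)[of j] dist_lipschitz(1)[of j k] that n dk by simp
    next
      case False
      then show ?thesis using dist_pos_le(2)[of j] dist_lipschitz(2)[of k j] that n dk by simp
    qed
    have "f \<in> {es ! k, es ! (k - 1)}" if f: "f \<in> C - T" for f
    proof -
      obtain j where j: "j < card C" "es ! j = f" "f \<in> E - T" by (rule nontree_index[OF f])
      have "odd (d (p j) + d (p (Suc j)))"
      proof (cases "j < k")
        case True
        then show ?thesis using dist[of j] dist[of "Suc j"] j n by simp
      next
        case False
        then have "d (p j) = Suc (d (p (Suc j)))" using dist[of j] dist[of "Suc j"] j n by auto
        then show ?thesis by simp
      qed
      then have "even (card (fc f))" using fc_nth(2)[of j] j by auto
      then have "card C \<le> card (fc f)" using min fc_cycle j by blast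
      then have "j = k \<or> Suc j = k" using even_fc_antipodal[OF n, of j] j by auto
      then show ?thesis using j by auto
    qed
    then show ?thesis using small by blast
  next
    case False
    obtain i j where ij: "consecutive i j" "fc (es ! i) \<inter> fc (es ! j) \<noteq> {}"
    \<comment> \<open>With a constantly true predicate the parity is that of the number of
      edges.\<close>
    proof (rule consecutive_meet[of "\<lambda>_. True"])
      show "odd (card {h \<in> fc e. True})" if "e \<in> C - T" for e using False that by simp
    qed (use even min in auto)
    note c = consecutiveD[OF ij(1)]
    let ?D = "symdiff (fc (es ! i)) (fc (es ! j))"
    have "is_cycle V E ends ?D" using symdiff_fc_cycle c ij by blast
    moreover have "even (card ?D)"
      using even_card_symdiff[OF finite_fc finite_fc, OF c(1,2)] False c(6,7) by blast
    \<comment> \<open>As \<open>d (p i)\<close> is at most \<open>i\<close> and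
      \<open>d (p (Suc j))\<close> at most \<open>card C - Suc j\<close>, this forces equality in
      both.\<close>
    ultimately have D: "card C \<le> d (p i) + (Suc j - i) + d (p (Suc j))"
      using min card_symdiff_consecutive[OF ij(1)] le_trans by blast
    \<comment> \<open>A third non-tree edge joins two vertices at equal distance from the root, so \<open>C\<close> is not
      geodesic there and the bound above becomes strict.\<close>
    have "f \<in> {es ! i, es ! j}" if f: "f \<in> C - T" for f
    proof -
      obtain l where l: "l < card C" "es ! l = f" "f \<in> E - T" by (rule nontree_index[OF f])
      have "even (d (p l) + d (p (Suc l)))" using fc_nth(2)[of l] False f l by auto
      then have flat: "d (p l) = d (p (Suc l))"
        using dist_Suc[OF l(1)]
        by (metis even_Suc even_add le_SucE le_antisym)
      have "\<not> l < i"
      proof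
        assume "l < i"
        then have "d (p i) < i"
          using flat dist_pos_le(1)[of l] dist_lipschitz(1)[of "Suc l" i] c(4,5) l(1) by simp
        then show False using D dist_pos_le(2)[of "Suc j"] c(4,5) by simp
      qed
      moreover have "\<not> j < l"
      proof
        assume "j < l"
        then have "d (p (Suc j)) < card C - Suc j"
          using flat dist_pos_le(2)[of "Suc l"] dist_lipschitz(2)[of "Suc j" l] c(4,5) l(1) by simp
        then show False using D dist_pos_le(1)[of i] c(4,5) by simp
      qed
      ultimately have "l = i \<or> l = j"
        using ij(1) l unfolding consecutive_def by (metis DiffD2 linorder_neqE_nat)
      then show ?thesis using l by auto
    qed
    then show ?thesis using small by blast
  qed
qed

text \<open>Minimality among all cycles bounds \<open>card (fc f)\<close> below whatever its parity.
  With \<open>card C = 2 * k + 1\<close> the arc bounds allow this only for the middle edge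
  \<open>es ! k\<close>.\<close>

lemma shortest_odd_cycle:
  assumes odd: "odd (card C)" and min: "\<And>D. is_cycle V E ends D \<Longrightarrow> card C \<le> card D"
  shows "C \<in> fundamental_cycles V E ends T"
proof -
  obtain k where n: "card C = 2 * k + 1" using odd by (elim oddE)
  have "f = es ! k" if f: "f \<in> C - T" for f
  proof -
    obtain j where j: "j < card C" "es ! j = f" "f \<in> E - T" by (rule nontree_index[OF f])
    have "card C \<le> card (fc f)" using min fc_cycle j by blast
    then have "j = k"
      using fc_nth(1)[of j] dist_pos_le[of j] dist_pos_le[of "Suc j"] j n by auto
    then show ?thesis using j by auto
  qed
  then have C: "C - T = {es ! k}" using cycle_minus_tree_nonempty by blast
  then have "es ! k \<in> E - T" using cycle_subset by blast
  then show ?thesis using C cycle_eq_fc fc_in_fundamental_cycles by metis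
qed

end

section \<open>Choosing a root on the cycle and assembling the three claims\<close>

lemma (in finite_graph) rooted_cycle_exists:
  assumes C: "is_cycle V E ends C" and bfs: "\<forall>x\<in>V. bfs_tree V E ends x (Tr x)"
  obtains x es p where "x \<in> V" "rooted_cycle V E ends x (Tr x) C es p"
proof -
  have CE: "C \<subseteq> E" "C \<noteq> {}" using C by (auto simp: is_cycle_def)
  then obtain e where e: "e \<in> C" "ends e \<noteq> {}" using ends_nonempty by blast
  then obtain x where x: "x \<in> verts ends C" by (auto simp: verts_def)
  then have xV: "x \<in> V" using verts_subset CE by blast
  obtain es where es: "walk V E ends x es x" "distinct es" "set es = C"
    using cycle_closed_trail[OF C x] .
  obtain p where p: "p 0 = x" "p (length es) = x"
    "\<And>i. i < length es \<Longrightarrow> ends (es ! i) = {p i, p (Suc i)}" "\<And>i. i \<le> length es \<Longrightarrow> p i \<in> V"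
    using walk_positions[OF es(1)] by metis
  have "rooted_cycle V E ends x (Tr x) C es p"
    by unfold_locales (use C bfs xV es p in auto)
  then show ?thesis using that xV by blast
qed

theorem theoremA:
  fixes V :: "'a set" and E :: "'e set" and ends :: "'e \<Rightarrow> 'a set"
    and rot :: "'a \<Rightarrow> 'e list" and lam :: "'e \<Rightarrow> int" and Tr :: "'a \<Rightarrow> 'e set"
  assumes G: "graph V E ends" and conn: "connected_graph V E ends"
    and rot: "\<forall>v\<in>V. distinct (rot v) \<and> set (rot v) = {e\<in>E. v \<in> ends e}"
    and sig: "\<forall>e\<in>E. lam e \<in> {-1, 1}"
    and bfs: "\<forall>x\<in>V. bfs_tree V E ends x (Tr x)"
  shows
    "((\<exists>C. is_cycle V E ends C \<and> twosided lam C) \<longrightarrow>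
        (\<exists>C\<in>Cyc1 V E ends Tr \<union> Cyc2 V E ends Tr. twosided lam C \<and>
           (\<forall>D. is_cycle V E ends D \<and> twosided lam D \<longrightarrow> card C \<le> card D)))
     \<and> (\<forall>C. is_cycle V E ends C \<and> even (card C) \<and>
           (\<forall>D. is_cycle V E ends D \<and> even (card D) \<longrightarrow> card C \<le> card D)
           \<longrightarrow> C \<in> Cyc1 V E ends Tr \<union> Cyc2 V E ends Tr)
     \<and> ((\<exists>C. is_cycle V E ends C \<and> odd (card C) \<and>
            (\<forall>D. is_cycle V E ends D \<longrightarrow> card C \<le> card D)) \<longrightarrow>
        (\<forall>C. is_cycle V E ends C \<and> odd (card C) \<and>
           (\<forall>D. is_cycle V E ends D \<and> odd (card D) \<longrightarrow> card C \<le> card D)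
           \<longrightarrow> C \<in> Cyc1 V E ends Tr))"
proof (intro conjI impI allI)
  interpret finite_graph V E ends using G by unfold_locales
  have cyc1: "D \<in> Cyc1 V E ends Tr" if "x \<in> V" "D \<in> fundamental_cycles V E ends (Tr x)" for x D
    using that by (auto simp: Cyc1_def)
  {
    assume "\<exists>C. is_cycle V E ends C \<and> twosided lam C"
    then obtain C where C: "is_cycle V E ends C" "twosided lam C"
      and min: "\<And>D. is_cycle V E ends D \<Longrightarrow> twosided lam D \<Longrightarrow> card C \<le> card D"
      using ex_has_least_nat[of "\<lambda>C. is_cycle V E ends C \<and> twosided lam C" _ card] by blast
    obtain x es p where x: "x \<in> V" and "rooted_cycle V E ends x (Tr x) C es p"
      using rooted_cycle_exists[OF C(1) bfs] .
    then interpret rooted_cycle V E ends x "Tr x" C es p by simp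
    obtain D where "D \<in> fundamental_cycles V E ends (Tr x) \<or> is_cycle V E ends D \<and>
        (\<exists>A \<in> fundamental_cycles V E ends (Tr x). \<exists>B \<in> fundamental_cycles V E ends (Tr x).
          D = symdiff A B)"
      and D: "twosided lam D" "card D \<le> card C"
      using minimal_parity_cycle[of "\<lambda>h. lam h = -1"] C min unfolding twosided_def by blast
    then have "D \<in> Cyc1 V E ends Tr \<union> Cyc2 V E ends Tr"
      using cyc1[OF x] unfolding Cyc2_def by blast
    then show "\<exists>C\<in>Cyc1 V E ends Tr \<union> Cyc2 V E ends Tr. twosided lam C \<and>
        (\<forall>D. is_cycle V E ends D \<and> twosided lam D \<longrightarrow> card C \<le> card D)"
      using D min le_trans by blast
  next
    fix C
    assume C: "is_cycle V E ends C \<and> even (card C) \<and>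
      (\<forall>D. is_cycle V E ends D \<and> even (card D) \<longrightarrow> card C \<le> card D)"
    obtain x es p where x: "x \<in> V" and "rooted_cycle V E ends x (Tr x) C es p"
      using rooted_cycle_exists[OF conjunct1[OF C] bfs] .
    then interpret rooted_cycle V E ends x "Tr x" C es p by simp
    show "C \<in> Cyc1 V E ends Tr \<union> Cyc2 V E ends Tr"
      using minimal_even_cycle C cyc1[OF x] unfolding Cyc2_def by blast
  next
    fix C
    assume girth: "\<exists>C. is_cycle V E ends C \<and> odd (card C) \<and>
        (\<forall>D. is_cycle V E ends D \<longrightarrow> card C \<le> card D)"
      and C: "is_cycle V E ends C \<and> odd (card C) \<and>
        (\<forall>D. is_cycle V E ends D \<and> odd (card D) \<longrightarrow> card C \<le> card D)"
    obtain x es p where x: "x \<in> V" and "rooted_cycle V E ends x (Tr x) C es p"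
      using rooted_cycle_exists[OF conjunct1[OF C] bfs] .
    then interpret rooted_cycle V E ends x "Tr x" C es p by simp
    \<comment> \<open>The girth cycle is odd, so \<open>C\<close> is no longer than it and hence a
      shortest cycle overall.\<close>
    have "card C \<le> card D" if "is_cycle V E ends D" for D
      using girth C that le_trans by blast
    then show "C \<in> Cyc1 V E ends Tr" using shortest_odd_cycle C cyc1[OF x] by blast
  }
qed

end
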